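(* Let $G$ be a $C_{4k}$-free bipartite graph. Then (1) $\operatorname{rank}(G)=\operatorname{rank}(C_S(G))+\operatorname{rank}(C_N(G))=\sum_{H\in\mathcal{K}(C_S(G))}\operatorname{rank}(H)+\sum_{H\in\mathcal{K}(C_N(G))}\operatorname{rank}(H)$; (2) $\operatorname{Rank}(G)=\operatorname{Rank}(C_S(G))\!\uparrow^{G}\oplus\operatorname{Rank}(C_N(G))\!\uparrow^{G}$; (3) $\operatorname{Rank}(G)=\bigoplus_{H\in\mathcal{K}(C_S(G))}\operatorname{Rank}(H)\!\uparrow^{G}\oplus\bigoplus_{H\in\mathcal{K}(C_N(G))}\operatorname{Rank}(H)\!\uparrow^{G}$.
   Context: All graphs are finite, simple and undirected. A graph is a $C_{4k}$-free bipartite graph if it is bipartite and contains no cycle whose length is a multiple of $4$. For a graph $G$ with adjacency matrix $A(G)$, $\operatorname{Rank}(G)\subseteq\mathbb{R}^{V(G)}$ is the column space of $A(G)$ and $\operatorname{rank}(G)$ its dimension; $\operatorname{Null}(G)$ is the null space of $A(G)$. $\operatorname{Supp}(G)$ is the set of vertices $v$ with $\vec{x}_v\neq0$ for some $\vec{x}\in\operatorname{Null}(G)$; $\operatorname{Core}(G)$ is the set of vertices adjacent to some vertex of $\operatorname{Supp}(G)$; $\operatorname{Npart}(G)=V(G)\setminus(\operatorname{Supp}(G)\cup\operatorname{Core}(G))$. $C_S(G)$ is the subgraph induced by $\operatorname{Supp}(G)\cup\operatorname{Core}(G)$ and $C_N(G)$ the subgraph induced by $\operatorname{Npart}(G)$.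 $\mathcal{K}(F)$ is the set of connected components of $F$. For a subgraph $H$ of $G$ and $\vec{y}\in\mathbb{R}^{V(H)}$, the lift $\vec{y}\!\uparrow^{G}$ agrees with $\vec{y}$ on $V(H)$ and is $0$ on $V(G)\setminus V(H)$; for a set $Y$ of vectors, $Y\!\uparrow^{G}=\{\vec{y}\!\uparrow^{G}:\vec{y}\in Y\}$. *)

theory Defs
  imports "HOL-Analysis.Analysis" "Graph_Theory.Digraph_Component"
begin

text \<open>A finite simple undirected graph is a digraph in the sense of the locale \<^locale>\<open>graph\<close>: finite,
  loop-free, without parallel arcs, and symmetric, each undirected edge being represented by its two
  orientations. The vertex set is an arbitrary subset of the finite type \<^typ>\<open>'a\<close>.\<close>

definition bipartite :: "('a, 'b) pre_digraph \<Rightarrow> bool" where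
  "bipartite G \<longleftrightarrow> (\<exists>A B. verts G = A \<union> B \<and> A \<inter> B = {} \<and>
     (\<forall>(u, v) \<in> arcs_ends G. u \<in> A \<and> v \<in> B \<or> u \<in> B \<and> v \<in> A))"

text \<open>In a symmetric digraph, \<^const>\<open>pre_digraph.cycle\<close> also admits the closed walk of length 2 along an edge
  and back. Its directed cycles of length at least 3 are exactly the oriented cycles of the undirected
  graph, so the walks of length 2 do not affect the condition below.\<close>

definition C4k_free_bipartite :: "('a, 'b) pre_digraph \<Rightarrow> bool" where
  "C4k_free_bipartite G \<longleftrightarrow> bipartite G \<and> \<not> (\<exists>p. pre_digraph.cycle G p \<and> 4 dvd length p)"

text \<open>The qualified name avoids the topological notion of the same name.\<close>

definition conn_components :: "('a, 'b) pre_digraph \<Rightarrow> ('a, 'b) pre_digraph set" where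
  "conn_components F = {H. pre_digraph.max_subgraph F Digraph_Component.connected H}"

text \<open>A vector indexed by the vertices of \<open>G\<close> is represented by a vector over the whole vertex type that
  vanishes off \<open>verts G\<close>. Matrices are padded by zeros in the same way.\<close>

definition vecs :: "('a::finite, 'b) pre_digraph \<Rightarrow> (real ^ 'a) set" where
  "vecs G = {x. \<forall>v. v \<notin> verts G \<longrightarrow> x $ v = 0}"

definition adj_matrix :: "('a::finite, 'b) pre_digraph \<Rightarrow> real ^ 'a ^ 'a" where
  "adj_matrix G = (\<chi> u v. if (u, v) \<in> arcs_ends G then 1 else 0)"

definition Rank :: "('a::finite, 'b) pre_digraph \<Rightarrow> (real ^ 'a) set" where
  "Rank G = span ((\<lambda>v. column v (adj_matrix G)) ` verts G)"

definition graph_rank :: "('a::finite, 'b) pre_digraph \<Rightarrow> nat" where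
  "graph_rank G = dim (Rank G)"

definition Null :: "('a::finite, 'b) pre_digraph \<Rightarrow> (real ^ 'a) set" where
  "Null G = {x \<in> vecs G. adj_matrix G *v x = 0}"

definition Supp :: "('a::finite, 'b) pre_digraph \<Rightarrow> 'a set" where
  "Supp G = {v \<in> verts G. \<exists>x \<in> Null G. x $ v \<noteq> 0}"

definition Core :: "('a::finite, 'b) pre_digraph \<Rightarrow> 'a set" where
  "Core G = {v \<in> verts G. \<exists>u \<in> Supp G. (u, v) \<in> arcs_ends G}"

definition Npart :: "('a::finite, 'b) pre_digraph \<Rightarrow> 'a set" where
  "Npart G = verts G - (Supp G \<union> Core G)"

definition C_S :: "('a::finite, 'b) pre_digraph \<Rightarrow> ('a, 'b) pre_digraph" where
  "C_S G = G \<restriction> (Supp G \<union> Core G)"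

definition C_N :: "('a::finite, 'b) pre_digraph \<Rightarrow> ('a, 'b) pre_digraph" where
  "C_N G = G \<restriction> Npart G"

text \<open>The lift of a vector from \<open>H\<close> to any larger graph. It depends only on the entries at vertices of
  \<open>H\<close>; under the zero-padding convention it does not depend on the larger graph and fixes \<^term>\<open>vecs H\<close>
  pointwise.\<close>

definition lift :: "('a::finite, 'b) pre_digraph \<Rightarrow> real ^ 'a \<Rightarrow> real ^ 'a" where
  "lift H y = (\<chi> v. if v \<in> verts H then y $ v else 0)"

text \<open>\<open>W\<close> is the internal direct sum of the finite family of subspaces \<open>U i\<close>, \<open>i \<in> I\<close>. The family is
  indexed, so equal summands at different indices are not identified.\<close>

definition is_direct_sum :: "'v::real_vector set \<Rightarrow> 'i set \<Rightarrow> ('i \<Rightarrow> 'v set) \<Rightarrow> bool" where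
  "is_direct_sum W I U \<longleftrightarrow>
     finite I \<and> (\<forall>i\<in>I. subspace (U i)) \<and>
     W = {\<Sum>i\<in>I. f i | f. \<forall>i\<in>I. f i \<in> U i} \<and>
     (\<forall>f. (\<forall>i\<in>I. f i \<in> U i) \<and> (\<Sum>i\<in>I. f i) = 0 \<longrightarrow> (\<forall>i\<in>I. f i = 0))"

end

theory Submission
  imports Defs
begin

text \<open>The column space of a symmetric matrix is the orthogonal complement of its null space, so it
  suffices to compare null spaces. The combinatorial input is that, in a \<open>C\<^sub>4\<^sub>k\<close>-free bipartite graph with
  adjacency matrix \<open>A\<close>, no edge joins the supports of vectors \<open>w\<close> and \<open>x\<close> such that \<open>A x\<close> vanishes on the
  support of \<open>w\<close> and \<open>A w\<close> on the support of \<open>x\<close>. For \<open>w, x\<close> in the null space this makes the support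
  independent. For \<open>w\<close> concentrated on the core it shows that the core-by-support block of \<open>A\<close> has full
  row rank. Hence \<open>C\<^sub>S\<close> has the same null space as \<open>G\<close>, and \<open>C\<^sub>N\<close> is nonsingular.\<close>

section \<open>Internal direct sums\<close>

text \<open>Lets the generation half of \<open>is_direct_sum\<close> be proved by span inclusions,
  and shows that a direct sum is again a subspace.\<close>

lemma set_of_sums_eq_span:
  assumes "finite I" "\<And>i. i \<in> I \<Longrightarrow> subspace (U i)"
  shows "{\<Sum>i\<in>I. f i | f. \<forall>i\<in>I. f i \<in> U i} = span (\<Union>i\<in>I. U i)" (is "?L = _")
proof
  show "?L \<subseteq> span (\<Union>i\<in>I. U i)"
    by (auto intro!: span_sum intro: span_base)
  have "subspace ?L"
  proof (rule subspaceI)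
    show "0 \<in> ?L"
      using assms(2) by (auto simp: subspace_0 intro!: exI[of _ "\<lambda>_. 0"])
    fix x y assume "x \<in> ?L" "y \<in> ?L"
    then obtain f g where "x = (\<Sum>i\<in>I. f i)" "y = (\<Sum>i\<in>I. g i)"
      "\<forall>i\<in>I. f i \<in> U i" "\<forall>i\<in>I. g i \<in> U i" by blast
    then show "x + y \<in> ?L"
      using assms(2) by (auto simp: sum.distrib subspace_add intro!: exI[of _ "\<lambda>i. f i + g i"])
  next
    fix c x assume "x \<in> ?L"
    then obtain f where "x = (\<Sum>i\<in>I. f i)" "\<forall>i\<in>I. f i \<in> U i" by blast
    then show "c *\<^sub>R x \<in> ?L"
      using assms(2) by (auto simp: scaleR_sum_right subspace_scale intro!: exI[of _ "\<lambda>i. c *\<^sub>R f i"])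
  qed
  moreover have "U i \<subseteq> ?L" if "i \<in> I" for i
  proof
    fix x assume "x \<in> U i"
    moreover have "x = (\<Sum>j\<in>I. if j = i then x else 0)"
      using that assms(1) by simp
    ultimately show "x \<in> ?L"
      using assms(2) by (auto simp: subspace_0 intro!: exI[of _ "\<lambda>j. if j = i then x else 0"])
  qed
  ultimately show "span (\<Union>i\<in>I. U i) \<subseteq> ?L"
    by (intro span_minimal) blast+
qed

lemma is_direct_sum_subspace:
  assumes "is_direct_sum W I U"
  shows "subspace W"
  using assms set_of_sums_eq_span[of I U] unfolding is_direct_sum_def by (metis subspace_span)

text \<open>Induction on the index set: by independence a new summand \<open>U j\<close> meets the
  sum \<open>W'\<close> of the others only in 0, so the dimensions add.\<close>

lemma dim_is_direct_sum:
  fixes W :: "'v::euclidean_space set"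
  assumes "is_direct_sum W I U"
  shows "dim W = (\<Sum>i\<in>I. dim (U i))"
proof -
  have "finite I" using assms by (simp add: is_direct_sum_def)
  then show ?thesis using assms
  proof (induction I arbitrary: W)
    case empty
    then have "W = {0}" by (simp add: is_direct_sum_def)
    then show ?case by simp
  next
    case (insert j I)
    define W' where "W' = {\<Sum>i\<in>I. f i | f. \<forall>i\<in>I. f i \<in> U i}"
    have sub: "subspace (U i)" if "i \<in> insert j I" for i
      using insert.prems that by (auto simp: is_direct_sum_def)
    have W: "W = {\<Sum>i\<in>insert j I. f i | f. \<forall>i\<in>insert j I. f i \<in> U i}"
      using insert.prems by (simp add: is_direct_sum_def)
    have indep: "\<forall>i\<in>insert j I. f i = 0"
      if "\<forall>i\<in>insert j I. f i \<in> U i" "(\<Sum>i\<in>insert j I. f i) = 0" for f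
      using insert.prems that unfolding is_direct_sum_def by blast
    \<comment> \<open>As \<open>j\<close> lies outside \<open>I\<close>, a family on
      \<open>I\<close> may take any value at \<open>j\<close>. The values 0, \<open>x\<close> and
      \<open>- x\<close> serve in turn for the directness of \<open>W'\<close>, for \<open>W\<close>
      as a sum of two spaces, and for their trivial intersection.\<close>
    have upd: "(\<Sum>i\<in>I. (f(j := y)) i) = (\<Sum>i\<in>I. f i)" for f :: "_ \<Rightarrow> 'v" and y
      using insert.hyps(2) by (intro sum.cong) auto
    have direct: "is_direct_sum W' I U"
      unfolding is_direct_sum_def
    proof (intro conjI allI impI)
      fix f assume f: "(\<forall>i\<in>I. f i \<in> U i) \<and> (\<Sum>i\<in>I. f i) = 0"
      have "\<forall>i\<in>insert j I. (f(j := 0)) i = 0"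
        using f insert.hyps upd[of f 0] sub by (intro indep) (auto simp: subspace_0)
      then show "\<forall>i\<in>I. f i = 0" using insert.hyps(2) by (metis fun_upd_other insertCI)
    qed (use insert.hyps sub in \<open>auto simp: W'_def\<close>)
    have "W = {x + y | x y. x \<in> U j \<and> y \<in> W'}"
    proof
      show "W \<subseteq> {x + y | x y. x \<in> U j \<and> y \<in> W'}"
        using insert.hyps unfolding W W'_def by auto
      show "{x + y | x y. x \<in> U j \<and> y \<in> W'} \<subseteq> W"
      proof clarify
        fix x y assume "x \<in> U j" "y \<in> W'"
        then obtain f where f: "y = (\<Sum>i\<in>I. f i)" "\<forall>i\<in>I. f i \<in> U i"
          by (auto simp: W'_def)
        then show "x + y \<in> W"
          using insert.hyps upd[of f x] \<open>x \<in> U j\<close>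
          unfolding W by (auto intro!: exI[of _ "f(j := x)"])
      qed
    qed
    moreover have "U j \<inter> W' = {0}"
    proof -
      have "x = 0" if "x \<in> U j" "x \<in> W'" for x
      proof -
        obtain f where f: "x = (\<Sum>i\<in>I. f i)" "\<forall>i\<in>I. f i \<in> U i"
          using \<open>x \<in> W'\<close> by (auto simp: W'_def)
        have "\<forall>i\<in>insert j I. (f(j := - x)) i = 0"
          using f insert.hyps upd[of f "- x"] \<open>x \<in> U j\<close> sub by (intro indep) (auto simp: subspace_neg)
        then show ?thesis by simp
      qed
      then show ?thesis
        using sub is_direct_sum_subspace[OF direct] by (auto simp: subspace_0)
    qed
    ultimately have "dim W = dim (U j) + dim W'"
      using dim_sums_Int[of "U j" W'] sub is_direct_sum_subspace[OF direct] by simp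
    then show ?case using insert.IH[OF direct] insert.hyps by simp
  qed
qed

lemma is_direct_sum_sum_in:
  assumes "is_direct_sum W I U" "\<forall>i\<in>I. f i \<in> U i"
  shows "(\<Sum>i\<in>I. f i) \<in> W"
  using assms by (auto simp: is_direct_sum_def)

lemma is_direct_sum_zero:
  assumes "is_direct_sum W I U" "\<forall>i\<in>I. f i \<in> U i" "(\<Sum>i\<in>I. f i) = 0"
  shows "\<forall>i\<in>I. f i = 0"
  using assms unfolding is_direct_sum_def by blast

text \<open>Refines a two-term direct sum by decomposing both terms. The disjoint union of the index
  sets keeps summands apart even if \<open>I\<close> and \<open>J\<close> overlap.\<close>

lemma is_direct_sum_Plus:
  assumes W: "is_direct_sum W (UNIV :: bool set) (case_bool W1 W2)"
    and W1: "is_direct_sum W1 I U" and W2: "is_direct_sum W2 J V"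
  shows "is_direct_sum W (I <+> J) (case_sum U V)"
  unfolding is_direct_sum_def
proof (intro conjI allI impI)
  have fin: "finite I" "finite J" using W1 W2 by (auto simp: is_direct_sum_def)
  then show "finite (I <+> J)" by simp
  show "\<forall>i\<in>I <+> J. subspace (case_sum U V i)"
    using W1 W2 by (auto simp: is_direct_sum_def)
  have ball_Plus: "(\<forall>k\<in>I <+> J. Q k) \<longleftrightarrow> (\<forall>i\<in>I. Q (Inl i)) \<and> (\<forall>j\<in>J. Q (Inr j))" for Q
    by (auto simp: Plus_def)
  have sum_Plus: "(\<Sum>k\<in>I <+> J. f k) = (\<Sum>i\<in>I. f (Inl i)) + (\<Sum>j\<in>J. f (Inr j))"
    for f :: "_ \<Rightarrow> 'a"
    using fin by (simp add: sum.Plus)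
  have W_eq: "W = {x + y | x y. x \<in> W1 \<and> y \<in> W2}" (is "W = ?R")
  proof -
    have "W = {\<Sum>b\<in>UNIV. f b | f. \<forall>b\<in>UNIV. f b \<in> case_bool W1 W2 b}"
      using W by (simp add: is_direct_sum_def)
    also have "\<dots> = ?R"
    proof
      show "?R \<subseteq> {\<Sum>b\<in>UNIV. f b | f. \<forall>b\<in>UNIV. f b \<in> case_bool W1 W2 b}"
      proof clarify
        fix x y assume "x \<in> W1" "y \<in> W2"
        then show "\<exists>f. x + y = (\<Sum>b\<in>UNIV. f b) \<and> (\<forall>b\<in>UNIV. f b \<in> case_bool W1 W2 b)"
          by (intro exI[of _ "case_bool x y"]) (auto simp: UNIV_bool add.commute split: bool.split)
      qed
    qed (fastforce simp: UNIV_bool add.commute all_bool_eq)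
    finally show ?thesis .
  qed
  show "W = {\<Sum>k\<in>I <+> J. f k | f. \<forall>k\<in>I <+> J. f k \<in> case_sum U V k}" (is "W = ?S")
  proof
    show "W \<subseteq> ?S"
    proof
      fix z assume "z \<in> W"
      then obtain x y where "z = x + y" "x \<in> W1" "y \<in> W2" by (auto simp: W_eq)
      moreover obtain f where "x = (\<Sum>i\<in>I. f i)" "\<forall>i\<in>I. f i \<in> U i"
        using W1 \<open>x \<in> W1\<close> by (auto simp: is_direct_sum_def)
      moreover obtain g where "y = (\<Sum>j\<in>J. g j)" "\<forall>j\<in>J. g j \<in> V j"
        using W2 \<open>y \<in> W2\<close> by (auto simp: is_direct_sum_def)
      ultimately show "z \<in> ?S"
        by (auto simp: sum_Plus intro!: exI[of _ "case_sum f g"])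
    qed
    show "?S \<subseteq> W"
    proof clarify
      fix f assume f: "\<forall>k\<in>I <+> J. f k \<in> case_sum U V k"
      then have "(\<Sum>i\<in>I. f (Inl i)) \<in> W1 \<and> (\<Sum>j\<in>J. f (Inr j)) \<in> W2"
        unfolding ball_Plus using is_direct_sum_sum_in[OF W1, of "\<lambda>i. f (Inl i)"]
          is_direct_sum_sum_in[OF W2, of "\<lambda>j. f (Inr j)"] by auto
      then show "(\<Sum>k\<in>I <+> J. f k) \<in> W" unfolding W_eq sum_Plus by blast
    qed
  qed
  fix f assume f: "(\<forall>k\<in>I <+> J. f k \<in> case_sum U V k) \<and> (\<Sum>k\<in>I <+> J. f k) = 0"
  \<comment> \<open>Independence comes in two stages: the outer sum forces the partial sums
    \<open>x\<close> and \<open>y\<close> to vanish, then each inner sum forces its own terms to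
    vanish.\<close>
  define x where "x = (\<Sum>i\<in>I. f (Inl i))"
  define y where "y = (\<Sum>j\<in>J. f (Inr j))"
  have "x \<in> W1" "y \<in> W2"
    using f[unfolded ball_Plus] is_direct_sum_sum_in[OF W1, of "\<lambda>i. f (Inl i)"]
      is_direct_sum_sum_in[OF W2, of "\<lambda>j. f (Inr j)"] by (auto simp: x_def y_def)
  moreover have "x + y = 0" using f by (simp add: sum_Plus x_def y_def)
  ultimately have "\<forall>b\<in>UNIV. case_bool x y b = 0"
    by (intro is_direct_sum_zero[OF W]) (auto simp: UNIV_bool add.commute split: bool.split)
  then have "x = 0" "y = 0" by (auto simp: all_bool_eq)
  then have "\<forall>i\<in>I. f (Inl i) = 0" "\<forall>j\<in>J. f (Inr j) = 0"
    using f[unfolded ball_Plus] is_direct_sum_zero[OF W1, of "\<lambda>i. f (Inl i)"] is_direct_sum_zero[OF W2, of "\<lambda>j. f (Inr j)"]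
    by (auto simp: x_def y_def)
  then show "\<forall>k\<in>I <+> J. f k = 0" by auto
qed

text \<open>At a coordinate in \<open>P i\<close> only the term with index \<open>i\<close> can be
  nonzero, so a vanishing sum has vanishing terms. Below, the sets \<open>P i\<close> are vertex
  sets of subgraphs.\<close>

lemma is_direct_sum_disjoint_supports:
  fixes U :: "'i \<Rightarrow> (real ^ 'n) set"
  assumes "finite I" and sub: "\<And>i. i \<in> I \<Longrightarrow> subspace (U i)"
    and supp: "\<And>i x v. i \<in> I \<Longrightarrow> x \<in> U i \<Longrightarrow> v \<notin> P i \<Longrightarrow> x $ v = 0"
    and disj: "disjoint_family_on P I"
    and W: "W = span (\<Union>i\<in>I. U i)"
  shows "is_direct_sum W I U"
  unfolding is_direct_sum_def
proof (intro conjI allI impI ballI)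
  show "W = {\<Sum>i\<in>I. f i | f. \<forall>i\<in>I. f i \<in> U i}"
    using set_of_sums_eq_span[OF assms(1) sub] W by simp
  fix f i assume f: "(\<forall>i\<in>I. f i \<in> U i) \<and> (\<Sum>i\<in>I. f i) = 0" and i: "i \<in> I"
  show "f i = 0"
  proof (rule vec_eq_iff[THEN iffD2], rule allI)
    fix v
    show "f i $ v = 0 $ v"
    proof (cases "v \<in> P i")
      case True
      have "f k $ v = 0" if "k \<in> I - {i}" for k
        using that f i disj True supp[of k "f k" v] by (auto simp: disjoint_family_on_def)
      then have "(\<Sum>k\<in>I. f k $ v) = f i $ v"
        using assms(1) i by (subst sum.remove[of _ i]) auto
      moreover have "(\<Sum>k\<in>I. f k $ v) = (\<Sum>k\<in>I. f k) $ v" by simp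
      ultimately show ?thesis using f by simp
    qed (use f i supp in auto)
  qed
qed (use assms in auto)

section \<open>Cycles from sign patterns\<close>

text \<open>Without a positive term, the negated terms are nonnegative with sum zero, hence all
  zero. Applying this to \<open>f\<close> and to its negation yields both signs.\<close>

lemma ex_pos_and_neg_of_sum_eq_0:
  fixes f :: "'a \<Rightarrow> real"
  assumes "finite S" "(\<Sum>s\<in>S. f s) = 0" "s \<in> S" "f s \<noteq> 0"
  shows "(\<exists>t\<in>S. 0 < f t) \<and> (\<exists>t\<in>S. f t < 0)"
proof -
  have 1: "\<exists>t\<in>S. 0 < g t" if "(\<Sum>s\<in>S. g s) = 0" "g s \<noteq> 0" for g :: "'a \<Rightarrow> real"
  proof (rule ccontr)
    assume "\<not> ?thesis"
    then have "\<forall>t\<in>S. 0 \<le> - g t" by (auto simp: not_less)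
    moreover have "(\<Sum>s\<in>S. - g s) = 0" using that by (simp add: sum_negf)
    ultimately have "- g s = 0"
      using assms(1,3) sum_nonneg_eq_0_iff[of S "\<lambda>s. - g s"] by blast
    then show False using that by simp
  qed
  show ?thesis using 1[of f] 1[of "\<lambda>s. - f s"] assms by (simp add: sum_negf)
qed

lemma (in pre_digraph) cas_map_upt:
  assumes "\<And>k. i \<le> k \<Longrightarrow> k < j \<Longrightarrow> tail G (a k) = f k \<and> head G (a k) = f (Suc k)"
    and "i \<le> j"
  shows "cas (f i) (map a [i..<j]) (f j)"
  using assms(2,1)
proof (induction i rule: inc_induct)
  case (step i)
  then show ?case by (simp add: upt_conv_Cons)
qed simp

text \<open>Following the walk to its first self-intersection, the closed part is a cycle, and \<open>\<phi>\<close>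
  determines the position modulo \<open>m\<close>.\<close>

lemma (in wf_digraph) ex_cycle_of_grading:
  fixes \<phi> :: "'a \<Rightarrow> nat"
  assumes "finite P" "P \<noteq> {}"
    and step: "\<And>v. v \<in> P \<Longrightarrow> \<exists>w\<in>P. v \<rightarrow>\<^bsub>G\<^esub> w \<and> \<phi> w mod m = Suc (\<phi> v) mod m"
  shows "\<exists>p. cycle p \<and> m dvd length p"
proof -
  obtain g where g: "\<And>v. v \<in> P \<Longrightarrow> g v \<in> P \<and> v \<rightarrow>\<^bsub>G\<^esub> g v \<and> \<phi> (g v) mod m = Suc (\<phi> v) mod m"
    using step by metis
  obtain v0 where "v0 \<in> P" using assms(2) by blast
  define f where "f i = (g ^^ i) v0" for i
  have f_in: "f i \<in> P" for i
    by (induction i) (use \<open>v0 \<in> P\<close> g in \<open>auto simp: f_def\<close>)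
  have f_edge: "f i \<rightarrow>\<^bsub>G\<^esub> f (Suc i)" for i
    using g[OF f_in[of i]] by (simp add: f_def)
  have f_grade: "\<phi> (f i) mod m = (\<phi> v0 + i) mod m" for i
  proof (induction i)
    case (Suc i)
    have "\<phi> (f (Suc i)) mod m = Suc (\<phi> (f i)) mod m"
      using g[OF f_in[of i]] by (simp add: f_def)
    also have "\<dots> = Suc (\<phi> v0 + i) mod m"
      using Suc by (metis mod_Suc_eq)
    finally show ?case by simp
  qed (simp add: f_def)
  have "\<exists>j. \<exists>i<j. f i = f j"
  proof (rule ccontr)
    assume "\<not> ?thesis"
    then have "inj f" by (metis injI linorder_neqE_nat)
    moreover have "finite (range f)" using f_in assms(1) by (meson finite_subset image_subset_iff)
    ultimately show False using finite_imageD infinite_UNIV_nat by blast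
  qed
  then obtain j where "\<exists>i<j. f i = f j" and least: "\<And>j'. j' < j \<Longrightarrow> \<not> (\<exists>i<j'. f i = f j')"
    using exists_least_iff[of "\<lambda>j. \<exists>i<j. f i = f j"] by blast
  then obtain i where i: "i < j" "f i = f j" by blast
  have "\<exists>e. e \<in> arcs G \<and> tail G e = f k \<and> head G e = f (Suc k)" for k
    using f_edge[of k] by (auto simp: arcs_ends_conv)
  then obtain a where a: "\<And>k. a k \<in> arcs G \<and> tail G (a k) = f k \<and> head G (a k) = f (Suc k)"
    by metis
  define p where "p = map a [i..<j]"
  have cas: "cas (f i) p (f i)"
    using cas_map_upt[of i j a f] a i by (simp add: p_def)
  have "f i \<in> verts G" using f_edge adj_in_verts by blast
  with cas have awalk: "awalk (f i) p (f i)"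
    using a by (auto simp: awalk_def p_def)
  \<comment> \<open>\<open>cycle\<close> asks for distinctness of the tail only, since the first
    vertex returns at the end.\<close>
  have "tl (awalk_verts (f i) p) = map (\<lambda>k. f (Suc k)) [i..<j]"
    using awalk_verts_conv'[OF cas] i a by (simp add: p_def comp_def)
  moreover have "inj_on (\<lambda>k. f (Suc k)) {i..<j}"
  proof (rule linorder_inj_onI')
    fix k l assume kl: "k \<in> {i..<j}" "l \<in> {i..<j}" "k < l"
    show "f (Suc k) \<noteq> f (Suc l)"
    \<comment> \<open>If \<open>Suc l = j\<close>, the later vertex is \<open>f i\<close>, so
      minimality of \<open>j\<close> is applied at \<open>Suc k\<close>, where
      \<open>i < Suc k < j\<close>.\<close>
    proof (cases "Suc l = j")
      case True
      then show ?thesis using kl least[of "Suc k"] i by auto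
    next
      case False
      then show ?thesis using kl least[of "Suc l"] by auto
    qed
  qed
  ultimately have "distinct (tl (awalk_verts (f i) p))"
    by (simp add: distinct_map)
  then have "cycle p" using awalk i by (auto simp: cycle_def p_def)
  moreover have "m dvd j - i"
  proof -
    have "(\<phi> v0 + j) mod m = (\<phi> v0 + i) mod m" using f_grade i by metis
    then have "m dvd (\<phi> v0 + j) - (\<phi> v0 + i)"
      using i by (metis mod_eq_dvd_iff_nat nat_add_left_cancel_le less_imp_le)
    then show ?thesis by simp
  qed
  ultimately show ?thesis by (auto simp: p_def)
qed

section \<open>Edges between supports of vectors\<close>

lemma adj_matrix_mult_nth:
  "(adj_matrix G *v x) $ u = (\<Sum>v | (u, v) \<in> arcs_ends G. x $ v)"
proof -
  have "(adj_matrix G *v x) $ u = (\<Sum>v\<in>UNIV. if (u, v) \<in> arcs_ends G then x $ v else 0)"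
    by (auto simp: matrix_vector_mult_def adj_matrix_def intro!: sum.cong)
  also have "\<dots> = (\<Sum>v | (u, v) \<in> arcs_ends G. x $ v)"
    by (simp add: sum.inter_filter[symmetric])
  finally show ?thesis .
qed

text \<open>If neither entry vanished, with \<open>u\<close> in the part \<open>X\<close>, the zero sums would let us walk forever
  with \<open>w\<close>-signs in \<open>X\<close> and \<open>x\<close>-signs in \<open>Y\<close> reading \<open>+ + - -\<close> periodically. The position in this
  pattern depends on the vertex only, so the walk closes up to a cycle of length divisible by 4.\<close>

lemma no_edge_between_supports:
  fixes G :: "('a::finite, 'b) pre_digraph"
  assumes "graph G" "C4k_free_bipartite G"
    and w: "\<And>u. x $ u \<noteq> 0 \<Longrightarrow> (adj_matrix G *v w) $ u = 0"
    and x: "\<And>u. w $ u \<noteq> 0 \<Longrightarrow> (adj_matrix G *v x) $ u = 0"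
    and uv: "(u, v) \<in> arcs_ends G"
  shows "w $ u = 0 \<or> x $ v = 0"
proof (rule ccontr)
  assume nz: "\<not> ?thesis"
  interpret graph G by fact
  obtain X Y where XY: "X \<inter> Y = {}" "u \<in> X"
    and bip: "\<And>a b. (a, b) \<in> arcs_ends G \<Longrightarrow> a \<in> X \<and> b \<in> Y \<or> a \<in> Y \<and> b \<in> X"
  proof -
    obtain A B where AB: "A \<inter> B = {}"
      "\<forall>(a, b) \<in> arcs_ends G. a \<in> A \<and> b \<in> B \<or> a \<in> B \<and> b \<in> A"
      using assms(2) by (auto simp: C4k_free_bipartite_def bipartite_def)
    show thesis
    proof (cases "u \<in> A")
      case True
      then show thesis using AB that[of A B] by blast
    next
      case False
      then show thesis using AB uv that[of B A] by blast
    qed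
  qed
  define z where "z a = (if a \<in> X then w $ a else x $ a)" for a
  \<comment> \<open>A nonzero neighbour makes the zero sum over all neighbours of \<open>a\<close>
    nontrivial, so neighbours of both signs exist.\<close>
  define P where "P = {a. z a \<noteq> 0 \<and> (\<exists>b. (a, b) \<in> arcs_ends G \<and> z b \<noteq> 0)}"
  \<comment> \<open>Positions 0 and 2 are the positive and negative vertices of \<open>X\<close>, 1
    and 3 those outside \<open>X\<close>. Vertices with \<open>z a = 0\<close> also get a value, but
    none lies in \<open>P\<close>.\<close>
  define \<phi> :: "'a \<Rightarrow> nat" where
    "\<phi> a = (if a \<in> X then if 0 < z a then 0 else 2 else if 0 < z a then 1 else 3)" for a
  have sum0: "(\<Sum>b | (a, b) \<in> arcs_ends G. z b) = 0" if "z a \<noteq> 0" for a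
  proof (cases "a \<in> X")
    case True
    then have "(\<Sum>b | (a, b) \<in> arcs_ends G. z b) = (\<Sum>b | (a, b) \<in> arcs_ends G. x $ b)"
      using XY bip by (intro sum.cong) (auto simp: z_def)
    then show ?thesis using x that True by (simp add: z_def adj_matrix_mult_nth)
  next
    case False
    then have "(\<Sum>b | (a, b) \<in> arcs_ends G. z b) = (\<Sum>b | (a, b) \<in> arcs_ends G. w $ b)"
      using XY bip by (intro sum.cong) (auto simp: z_def)
    then show ?thesis using w that False by (simp add: z_def adj_matrix_mult_nth)
  qed
  have "\<exists>b\<in>P. a \<rightarrow>\<^bsub>G\<^esub> b \<and> \<phi> b mod 4 = Suc (\<phi> a) mod 4" if a: "a \<in> P" for a
  proof -
    obtain c where c: "z a \<noteq> 0" "(a, c) \<in> arcs_ends G" "z c \<noteq> 0"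
      using a by (auto simp: P_def)
    have "(\<exists>b. (a, b) \<in> arcs_ends G \<and> 0 < z b) \<and> (\<exists>b. (a, b) \<in> arcs_ends G \<and> z b < 0)"
      using ex_pos_and_neg_of_sum_eq_0[OF _ sum0[OF c(1)], of c] c by auto
    \<comment> \<open>The sign is kept when leaving \<open>X\<close> and flipped when returning to
      it, which advances \<open>\<phi>\<close> by one modulo 4.\<close>
    then obtain b where b: "(a, b) \<in> arcs_ends G" "z b \<noteq> 0"
      "0 < z b \<longleftrightarrow> (a \<in> X \<longleftrightarrow> 0 < z a)"
      by (metis less_irrefl not_less_iff_gr_or_eq)
    have "b \<in> P" using b c graph_symmetric by (auto simp: P_def)
    moreover have "\<phi> b mod 4 = Suc (\<phi> a) mod 4"
      using b bip[OF b(1)] XY(1) by (auto simp: \<phi>_def)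
    ultimately show ?thesis using b by blast
  qed
  moreover have "u \<in> P"
    using nz XY uv bip[OF uv] by (auto simp: P_def z_def)
  ultimately obtain p where "cycle p" "4 dvd length p"
    using ex_cycle_of_grading[of P \<phi> 4] by fastforce
  then show False using assms(2) by (auto simp: C4k_free_bipartite_def)
qed

section \<open>Column spaces and connected components\<close>

lemma subspace_vecs: "subspace (vecs G)"
  by (auto simp: subspace_def vecs_def)

lemma Rank_subset_vecs:
  assumes "wf_digraph G"
  shows "Rank G \<subseteq> vecs G"
  using assms wf_digraph.adj_in_verts[OF assms] unfolding Rank_def
  by (intro span_minimal subspace_vecs) (auto simp: vecs_def column_def adj_matrix_def)

text \<open>Column spaces already vanish off the vertices, so under zero-padding all lifts in the
  final statement act as the identity.\<close>

lemma lift_image_Rank: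
  assumes "wf_digraph G"
  shows "lift G ` Rank G = Rank G"
proof -
  have "lift G y = y" if "y \<in> Rank G" for y
    using that Rank_subset_vecs[OF assms] by (auto simp: lift_def vecs_def vec_eq_iff)
  then show ?thesis by simp
qed

lemma transpose_adj_matrix:
  assumes "sym_digraph G"
  shows "transpose (adj_matrix G) = adj_matrix G"
  using sym_digraph.graph_symmetric[OF assms]
  by (auto simp: transpose_def adj_matrix_def vec_eq_iff)

lemma adj_matrix_self_adjoint:
  assumes "sym_digraph G"
  shows "x \<bullet> (adj_matrix G *v y) = (adj_matrix G *v x) \<bullet> y"
  by (metis dot_lmul_matrix transpose_adj_matrix[OF assms] vector_transpose_matrix)

lemma inner_column_adj_matrix:
  assumes "sym_digraph G"
  shows "x \<bullet> column v (adj_matrix G) = (adj_matrix G *v x) $ v"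
  using adj_matrix_self_adjoint[OF assms, of x "axis v 1"]
  by (simp add: matrix_vector_mult_basis inner_axis)

text \<open>Orthogonality to all columns means being killed by the symmetric matrix. The restriction
  to \<open>vecs G\<close> is essential: vectors of \<open>Null G\<close> vanish off
  \<open>verts G\<close> and do not constrain the coordinates there.\<close>

lemma Rank_eq_orthogonal_Null:
  assumes "sym_digraph G"
  shows "Rank G = {y \<in> vecs G. \<forall>x\<in>Null G. x \<bullet> y = 0}"
proof
  interpret sym_digraph G by fact
  have "x \<bullet> y = 0" if "x \<in> Null G" "y \<in> Rank G" for x y
  proof -
    have "orthogonal x y"
      using that unfolding Rank_def
      by (intro orthogonal_to_span[of y])
        (auto simp: orthogonal_def inner_column_adj_matrix[OF assms] Null_def)
    then show ?thesis by (simp add: orthogonal_def)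
  qed
  then show "Rank G \<subseteq> {y \<in> vecs G. \<forall>x\<in>Null G. x \<bullet> y = 0}"
    using Rank_subset_vecs[OF wf_digraph] by blast
  show "{y \<in> vecs G. \<forall>x\<in>Null G. x \<bullet> y = 0} \<subseteq> Rank G"
  proof clarify
    fix y assume y: "y \<in> vecs G" "\<forall>x\<in>Null G. x \<bullet> y = 0"
    \<comment> \<open>The residue \<open>z\<close> will turn out to be a null vector; it is then
      orthogonal to both \<open>y\<close> and \<open>r\<close>, hence to itself.\<close>
    obtain r z where r: "r \<in> span (Rank G)" and z: "\<And>w. w \<in> span (Rank G) \<Longrightarrow> orthogonal z w"
      and yrz: "y = r + z"
      using orthogonal_subspace_decomp_exists[of "Rank G" y] by blast
    have span_Rank: "span (Rank G) = Rank G" by (simp add: Rank_def span_span)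
    have "z \<in> vecs G"
      using y(1) r Rank_subset_vecs[OF wf_digraph] yrz subspace_diff[OF subspace_vecs, of y G r]
      unfolding span_Rank by auto
    moreover have "(adj_matrix G *v z) $ v = 0" for v
    proof (cases "v \<in> verts G")
      case True
      then have "orthogonal z (column v (adj_matrix G))"
        by (intro z) (simp add: span_Rank, simp add: Rank_def span_base)
      then show ?thesis by (simp add: orthogonal_def inner_column_adj_matrix[OF assms])
    next
      case False
      then show ?thesis using adj_in_verts by (auto simp: adj_matrix_mult_nth intro!: sum.neutral)
    qed
    ultimately have "z \<in> Null G" by (simp add: Null_def vec_eq_iff)
    then have "z \<bullet> y = 0" using y by simp
    moreover have "z \<bullet> r = 0" using z[OF r] by (simp add: orthogonal_def)
    ultimately have "z \<bullet> z = 0" by (simp add: yrz inner_add_right)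
    then show "y \<in> Rank G" using r yrz span_Rank by simp
  qed
qed

section \<open>Connected components\<close>

text \<open>Makes the library facts on strongly connected components available. Induced subgraphs of
  a symmetric digraph inherit symmetry, so for them connectedness and strong connectedness
  agree.\<close>

lemma (in sym_digraph) conn_components_eq_sccs: "conn_components G = sccs"
proof
  have strong: "strongly_connected H" if "induced_subgraph H G" "connected H" for H
    using that wf_digraph.symmetric_connected_imp_strongly_connected[of H]
      induced_graph_imp_symmetric[OF sym_arcs] wf_digraphI_induced by blast
  have conn: "connected H" if "strongly_connected H" "wf_digraph H" for H
    using that wf_digraph.reachable_mk_symmetricI[of H]
    by (auto simp: connected_def strongly_connected_def)
  have mono: "arc_mono connected"
    unfolding arc_mono_def spanning_def[symmetric]
    by (metis spanning_def subgraph_def wf_digraph.connected_spanning_imp_connected)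
  show "conn_components G \<subseteq> sccs"
  proof
    fix H assume "H \<in> conn_components G"
    then have H: "max_subgraph connected H" by (simp add: conn_components_def)
    have "max_subgraph strongly_connected H"
      using H strong[OF induced_subgraphI_arc_mono[OF H mono]] conn
      unfolding max_subgraph_def by (meson subgraph_def)
    then show "H \<in> sccs" by (simp add: sccs_altdef2)
  qed
  show "sccs \<subseteq> conn_components G"
  proof
    fix H assume "H \<in> sccs"
    then have H: "max_subgraph strongly_connected H" by (simp add: sccs_altdef2)
    have "H' = H" if H': "subgraph H H'" "subgraph H' G" "connected H'" for H'
    proof -
      \<comment> \<open>\<open>H'\<close> itself may contain an arc without its reverse; the induced
        subgraph on its vertices is symmetric and still connected.\<close>
      let ?K = "G \<restriction> verts H'"
      have K: "subgraph H' ?K" "induced_subgraph ?K G"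
        using H'(2) by (auto intro: subgraph_induce_subgraphI2 induced_induce dest: subgraph_imp_subverts)
      then have "connected ?K"
        using H'(3) mono K(1) unfolding arc_mono_def by (metis induce_subgraph_verts)
      then have "strongly_connected ?K" using strong K by blast
      moreover have "subgraph H ?K" using subgraph_trans H'(1) K(1) by blast
      ultimately have "H = ?K"
        using H K(2) unfolding max_subgraph_def by (metis induced_imp_subgraph)
      then have "subgraph H' H" using K(1) by simp
      with H'(1) show ?thesis
        by (intro pre_digraph.equality) (auto simp: subgraph_def compatible_def)
    qed
    moreover have "subgraph H G" "strongly_connected H" using H by (auto simp: max_subgraph_def)
    ultimately have "max_subgraph connected H"
      using conn[of H] unfolding max_subgraph_def by (metis subgraph_def)
    then show "H \<in> conn_components G" by (simp add: conn_components_def)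
  qed
qed

lemma (in sym_digraph) conn_components_cover:
  "(\<Union>H\<in>conn_components G. verts H) = verts G"
proof
  show "(\<Union>H\<in>conn_components G. verts H) \<subseteq> verts G"
    by (auto simp: conn_components_def max_subgraph_def subgraph_def)
  show "verts G \<subseteq> (\<Union>H\<in>conn_components G. verts H)"
  proof
    fix u assume "u \<in> verts G"
    then have "G \<restriction> {v. u \<rightarrow>\<^sup>* v} \<in> conn_components G" "u \<in> verts (G \<restriction> {v. u \<rightarrow>\<^sup>* v})"
      using induce_reachable_is_in_sccs by (auto simp: conn_components_eq_sccs)
    then show "u \<in> (\<Union>H\<in>conn_components G. verts H)" by blast
  qed
qed

text \<open>Adjacent vertices reach each other and so share a component. Hence the padded matrices
  of \<open>H\<close> and \<open>G\<close> have the same columns at vertices of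
  \<open>H\<close>.\<close>

lemma (in sym_digraph) conn_component_arcs_ends:
  assumes "H \<in> conn_components G" "v \<in> verts H"
  shows "(u, v) \<in> arcs_ends H \<longleftrightarrow> (u, v) \<in> arcs_ends G"
proof
  have ind: "induced_subgraph H G"
    using assms(1) by (simp add: conn_components_eq_sccs in_sccs_imp_induced)
  show "(u, v) \<in> arcs_ends G" if "(u, v) \<in> arcs_ends H"
    using that ind by (auto simp: induced_subgraph_def subgraph_def compatible_def arcs_ends_conv)
  show "(u, v) \<in> arcs_ends H" if uv: "(u, v) \<in> arcs_ends G"
  proof -
    have "verts H \<in> sccs_verts"
      using assms(1) by (auto simp: conn_components_eq_sccs sccs_verts_conv)
    moreover have "u \<rightarrow>\<^sup>* v" "v \<rightarrow>\<^sup>* u" using uv graph_symmetric by auto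
    ultimately have "u \<in> verts H"
      using assms(2) by (auto simp: in_sccs_verts_conv_reachable)
    then show ?thesis
      using uv ind assms(2)
      by (auto simp: induced_subgraph_def subgraph_def compatible_def arcs_ends_conv)
  qed
qed

lemma Rank_direct_sum_components:
  assumes "sym_digraph G"
  shows "is_direct_sum (Rank G) (conn_components G) (\<lambda>H. lift H ` Rank H)"
proof (rule is_direct_sum_disjoint_supports[where P = verts])
  interpret sym_digraph G by fact
  have wf: "wf_digraph H" if "H \<in> conn_components G" for H
    using that by (auto simp: conn_components_def max_subgraph_def subgraph_def)
  show "finite (conn_components G)"
    unfolding conn_components_eq_sccs
    by (rule finite_imageD[OF _ inj_on_verts_sccs]) simp
  show "subspace (lift H ` Rank H)" if "H \<in> conn_components G" for H
    using lift_image_Rank[OF wf[OF that]] by (simp add: Rank_def)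
  show "x $ v = 0" if "H \<in> conn_components G" "x \<in> lift H ` Rank H" "v \<notin> verts H" for H x v
    using that by (auto simp: lift_def)
  show "disjoint_family_on verts (conn_components G)"
    using scc_disj by (auto simp: disjoint_family_on_def conn_components_eq_sccs)
  have "column v (adj_matrix H) = column v (adj_matrix G)"
    if "H \<in> conn_components G" "v \<in> verts H" for H v
    using conn_component_arcs_ends[OF that] by (simp add: column_def adj_matrix_def)
  then have "(\<Union>H\<in>conn_components G. (\<lambda>v. column v (adj_matrix H)) ` verts H) =
      (\<lambda>v. column v (adj_matrix G)) ` verts G"
    using conn_components_cover by (simp add: image_UN[symmetric] cong: SUP_cong image_cong)
  then have "Rank G = span (\<Union>H\<in>conn_components G. (\<lambda>v. column v (adj_matrix H)) ` verts H)"
    by (simp add: Rank_def)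
  also have "\<dots> = span (\<Union>H\<in>conn_components G. Rank H)"
    unfolding Rank_def
    by (intro subset_antisym span_mono span_minimal subspace_span UN_mono UN_least order_refl span_superset)
      (auto intro!: span_mono)
  also have "\<dots> = span (\<Union>H\<in>conn_components G. lift H ` Rank H)"
    using lift_image_Rank[OF wf] by simp
  finally show "Rank G = span (\<Union>H\<in>conn_components G. lift H ` Rank H)" .
qed

section \<open>The support--core and null parts\<close>

lemma arcs_ends_induce_subgraph:
  "(u, v) \<in> arcs_ends (G \<restriction> S) \<longleftrightarrow> (u, v) \<in> arcs_ends G \<and> u \<in> S \<and> v \<in> S"
  by (auto simp: arcs_ends_conv)

lemma (in sym_digraph) sym_digraph_induce_subgraph:
  assumes "S \<subseteq> verts G"
  shows "sym_digraph (G \<restriction> S)"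
  using induced_graph_imp_graph[OF induced_induce[OF assms]] .

lemma adj_matrix_induce_subgraph_mult_nth:
  assumes "x \<in> vecs (G \<restriction> S)" "u \<in> S"
  shows "(adj_matrix (G \<restriction> S) *v x) $ u = (adj_matrix G *v x) $ u"
  unfolding adj_matrix_mult_nth
  using assms by (intro sum.mono_neutral_left) (auto simp: arcs_ends_induce_subgraph vecs_def)

text \<open>Rows of the padded matrix outside \<open>S\<close> are zero, so null vectors of
  \<open>C_S\<close> and \<open>C_N\<close> can be studied through the matrix of \<open>G\<close>
  alone.\<close>

lemma Null_induce_subgraph:
  "Null (G \<restriction> S) = {x \<in> vecs (G \<restriction> S). \<forall>u\<in>S. (adj_matrix G *v x) $ u = 0}"
proof -
  have "(adj_matrix (G \<restriction> S) *v x) $ u = 0" if "u \<notin> S" for x u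
    using that by (auto simp: adj_matrix_mult_nth arcs_ends_induce_subgraph intro!: sum.neutral)
  then show ?thesis
    using adj_matrix_induce_subgraph_mult_nth[of _ G S]
    by (fastforce simp: Null_def vec_eq_iff)
qed

lemma Null_nonzero_in_Supp: "x \<in> Null G \<Longrightarrow> x $ v \<noteq> 0 \<Longrightarrow> v \<in> Supp G"
  by (auto simp: Supp_def Null_def vecs_def)

lemma Supp_subset_verts: "Supp G \<subseteq> verts G" and Core_subset_verts: "Core G \<subseteq> verts G"
  by (auto simp: Supp_def Core_def)

context
  fixes G :: "('a::finite, 'b) pre_digraph"
  assumes G: "graph G" and C4k: "C4k_free_bipartite G"
begin

interpretation graph G by (rule G)

lemma no_edge_in_Supp:
  assumes "u \<in> Supp G" "v \<in> Supp G"
  shows "(u, v) \<notin> arcs_ends G"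
proof
  assume uv: "(u, v) \<in> arcs_ends G"
  obtain w x where "w \<in> Null G" "w $ u \<noteq> 0" "x \<in> Null G" "x $ v \<noteq> 0"
    using assms by (auto simp: Supp_def)
  then show False
    using no_edge_between_supports[OF G C4k, of x w u v] uv by (auto simp: Null_def)
qed

text \<open>A core vertex \<open>u\<close> has a neighbour \<open>v\<close> in the support of some
  null vector \<open>x\<close>. If \<open>w $ u\<close> were nonzero, the edge would join the
  supports of \<open>w\<close> and \<open>x\<close>, contrary to
  \<open>no_edge_between_supports\<close>.\<close>

lemma Core_vector_eq_0:
  assumes core: "\<And>u. u \<notin> Core G \<Longrightarrow> w $ u = 0"
    and supp: "\<And>u. u \<in> Supp G \<Longrightarrow> (adj_matrix G *v w) $ u = 0"
  shows "w = 0"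
proof -
  have "w $ u = 0" for u
  proof (rule ccontr)
    assume nz: "w $ u \<noteq> 0"
    then have "u \<in> Core G" using core by blast
    then obtain v where v: "v \<in> Supp G" "(v, u) \<in> arcs_ends G" by (auto simp: Core_def)
    then obtain x where x: "x \<in> Null G" "x $ v \<noteq> 0" by (auto simp: Supp_def)
    then show False
      using no_edge_between_supports[OF G C4k, of x w u v] graph_symmetric[OF v(2)] nz supp
        Null_nonzero_in_Supp[OF x(1)]
      by (auto simp: Null_def)
  qed
  then show ?thesis by (simp add: vec_eq_iff)
qed

lemma adj_matrix_mult_Supp_vector:
  assumes "\<And>v. v \<notin> Supp G \<Longrightarrow> z $ v = 0" "u \<notin> Core G"
  shows "(adj_matrix G *v z) $ u = 0"
  unfolding adj_matrix_mult_nth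
proof (intro sum.neutral ballI)
  fix v assume "v \<in> {v. (u, v) \<in> arcs_ends G}"
  then have "v \<notin> Supp G"
    using assms(2) graph_symmetric adj_in_verts by (auto simp: Core_def)
  then show "z $ v = 0" by (rule assms(1))
qed

text \<open>Dual to \<open>Core_vector_eq_0\<close>: injectivity of the transposed block gives
  surjectivity of the core-by-support block. The part of \<open>y\<close> orthogonal to the image
  satisfies the hypotheses of that lemma and vanishes.\<close>

lemma Core_vector_in_image_Supp:
  assumes "\<And>u. u \<notin> Core G \<Longrightarrow> y $ u = 0"
  obtains z where "\<And>v. v \<notin> Supp G \<Longrightarrow> z $ v = 0" "adj_matrix G *v z = y"
proof -
  define T where "T = (*v) (adj_matrix G) ` {z. \<forall>v. v \<notin> Supp G \<longrightarrow> z $ v = 0}"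
  have "subspace T"
    unfolding T_def
    by (intro linear_subspace_image matrix_vector_mul_linear) (auto simp: subspace_def)
  then have span_T: "span T = T" by simp
  obtain t r where t: "t \<in> span T" and r: "\<And>w. w \<in> span T \<Longrightarrow> orthogonal r w" and yr: "y = t + r"
    using orthogonal_subspace_decomp_exists[of T y] by blast
  have "r $ u = 0" if "u \<notin> Core G" for u
  proof -
    have "t $ u = 0"
      using t that adj_matrix_mult_Supp_vector unfolding span_T by (auto simp: T_def)
    then show ?thesis using assms[OF that] yr by simp
  qed
  moreover have "(adj_matrix G *v r) $ u = 0" if "u \<in> Supp G" for u
  proof -
    have "adj_matrix G *v axis u 1 \<in> T"
      using that unfolding T_def by (intro imageI) (auto simp: axis_def)
    then have "orthogonal r (column u (adj_matrix G))"
      using r by (simp add: span_T matrix_vector_mult_basis)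
    then show ?thesis
      by (simp add: orthogonal_def inner_column_adj_matrix[OF sym_digraph_axioms])
  qed
  ultimately have "r = 0" by (rule Core_vector_eq_0)
  then show thesis using t yr that unfolding span_T by (auto simp: T_def)
qed

lemma Null_C_S: "Null (C_S G) = Null G"
proof
  show "Null G \<subseteq> Null (C_S G)"
    unfolding C_S_def Null_induce_subgraph
    using Null_nonzero_in_Supp by (auto simp: Null_def vecs_def)
  show "Null (C_S G) \<subseteq> Null G"
  proof
    fix x assume "x \<in> Null (C_S G)"
    then have x: "\<And>v. v \<notin> Supp G \<union> Core G \<Longrightarrow> x $ v = 0"
      "\<And>u. u \<in> Supp G \<union> Core G \<Longrightarrow> (adj_matrix G *v x) $ u = 0"
      by (auto simp: C_S_def Null_induce_subgraph vecs_def)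
    \<comment> \<open>The core part of \<open>x\<close>. Since no edge lies inside the support,
      \<open>w\<close> and \<open>x\<close> have the same neighbour sums at support
      vertices.\<close>
    define w where "w = (\<chi> v. if v \<in> Core G then x $ v else 0)"
    have "w = 0"
    proof (rule Core_vector_eq_0)
      show "(adj_matrix G *v w) $ u = 0" if "u \<in> Supp G" for u
      proof -
        have "(adj_matrix G *v w) $ u = (adj_matrix G *v x) $ u"
          unfolding adj_matrix_mult_nth
          using no_edge_in_Supp that x(1) by (intro sum.cong) (auto simp: w_def)
        then show ?thesis using x(2) that by simp
      qed
    qed (simp add: w_def)
    then have supp: "x $ v = 0" if "v \<notin> Supp G" for v
      using that x(1)[of v] w_def by (cases "v \<in> Core G") (auto simp: vec_eq_iff dest: spec[of _ v])
    have "(adj_matrix G *v x) $ u = 0" for u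
      using x(2)[of u] adj_matrix_mult_Supp_vector[of x u] supp by (cases "u \<in> Core G") auto
    moreover have "x \<in> vecs G"
      using supp Supp_subset_verts by (auto simp: vecs_def)
    ultimately show "x \<in> Null G" by (simp add: Null_def vec_eq_iff)
  qed
qed

lemma Null_C_N: "Null (C_N G) = {0}"
proof
  show "{0} \<subseteq> Null (C_N G)"
    by (simp add: Null_def vecs_def)
  show "Null (C_N G) \<subseteq> {0}"
  proof
    fix y assume "y \<in> Null (C_N G)"
    then have y: "\<And>v. v \<notin> Npart G \<Longrightarrow> y $ v = 0"
      "\<And>u. u \<in> Npart G \<Longrightarrow> (adj_matrix G *v y) $ u = 0"
      by (auto simp: C_N_def Null_induce_subgraph vecs_def)
    have "(adj_matrix G *v y) $ u = 0" if "u \<notin> Core G" for u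
    proof (cases "u \<in> Npart G")
      case False
      \<comment> \<open>Here \<open>u\<close> is in \<open>Supp G\<close>, so its neighbours are in
        the core, or \<open>u\<close> is no vertex of \<open>G\<close> and has no
        neighbours.\<close>
      have "v \<notin> Npart G" if "(u, v) \<in> arcs_ends G" for v
        using that False \<open>u \<notin> Core G\<close> adj_in_verts[OF that] by (auto simp: Npart_def Core_def)
      then show ?thesis
        using y(1) by (auto simp: adj_matrix_mult_nth intro!: sum.neutral)
    qed (rule y(2))
    then obtain z where z: "\<And>v. v \<notin> Supp G \<Longrightarrow> z $ v = 0" "adj_matrix G *v z = adj_matrix G *v y"
      using Core_vector_in_image_Supp[of "adj_matrix G *v y"] by blast
    \<comment> \<open>A null vector vanishes on \<open>Npart G\<close>, where \<open>z\<close>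
      vanishes too; this forces \<open>y = 0\<close> there.\<close>
    have "y - z \<in> Null G"
      using z y(1) Supp_subset_verts
      by (auto simp: Null_def vecs_def Npart_def matrix_vector_mult_diff_distrib)
    have "y $ v = 0" for v
    proof (cases "v \<in> Npart G")
      case True
      then have "v \<notin> Supp G" by (simp add: Npart_def)
      then show ?thesis
        using Null_nonzero_in_Supp[OF \<open>y - z \<in> Null G\<close>, of v] z(1)[of v] by auto
    qed (rule y(1))
    then show "y \<in> {0}" by (simp add: vec_eq_iff)
  qed
qed

section \<open>Splitting the column space\<close>

lemma sym_digraph_C_S: "sym_digraph (C_S G)" and sym_digraph_C_N: "sym_digraph (C_N G)"
  unfolding C_S_def C_N_def
  by (intro sym_digraph_induce_subgraph; auto simp: Supp_def Core_def Npart_def)+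

text \<open>Membership in \<open>Rank G\<close> is orthogonality to \<open>Null G\<close>, which
  constrains only the coordinates in \<open>Supp G\<close>. The \<open>C_S\<close> part therefore
  carries the whole condition, and the \<open>C_N\<close> part is arbitrary.\<close>

lemma Rank_direct_sum_C_S_C_N:
  "is_direct_sum (Rank G) (UNIV :: bool set)
    (case_bool (lift (C_S G) ` Rank (C_S G)) (lift (C_N G) ` Rank (C_N G)))"
proof (rule is_direct_sum_disjoint_supports
    [where P = "case_bool (Supp G \<union> Core G) (Npart G)"])
  have lift_eq: "lift (C_S G) ` Rank (C_S G) = Rank (C_S G)" "lift (C_N G) ` Rank (C_N G) = Rank (C_N G)"
    using sym_digraph_C_S sym_digraph_C_N by (auto simp: lift_image_Rank sym_digraph_def)
  show "subspace (case_bool (lift (C_S G) ` Rank (C_S G)) (lift (C_N G) ` Rank (C_N G)) b)" for b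
    unfolding lift_eq by (simp add: Rank_def split: bool.split)
  show "x $ v = 0" if "x \<in> case_bool (lift (C_S G) ` Rank (C_S G)) (lift (C_N G) ` Rank (C_N G)) b"
    "v \<notin> case_bool (Supp G \<union> Core G) (Npart G) b" for b x v
    using that by (auto simp: lift_def C_S_def C_N_def split: bool.splits)
  show "disjoint_family_on (case_bool (Supp G \<union> Core G) (Npart G)) UNIV"
    by (auto simp: disjoint_family_on_def Npart_def split: bool.split)
  have Rank_C_S: "Rank (C_S G) = {y \<in> vecs (C_S G). \<forall>x\<in>Null G. x \<bullet> y = 0}"
    using Rank_eq_orthogonal_Null[OF sym_digraph_C_S] by (simp add: Null_C_S)
  have Rank_C_N: "Rank (C_N G) = vecs (C_N G)"
    using Rank_eq_orthogonal_Null[OF sym_digraph_C_N] by (simp add: Null_C_N)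
  have Rank_G: "Rank G = {y \<in> vecs G. \<forall>x\<in>Null G. x \<bullet> y = 0}"
    by (rule Rank_eq_orthogonal_Null) (rule sym_digraph_axioms)
  have Null_inner_cong: "x \<bullet> y = x \<bullet> y'"
    if "x \<in> Null G" "\<And>v. v \<in> Supp G \<Longrightarrow> y $ v = y' $ v" for x y y'
    unfolding inner_vec_def
    using that Null_nonzero_in_Supp[OF that(1)] by (intro sum.cong) auto
  have "Rank (C_S G) \<subseteq> Rank G"
    using Supp_subset_verts[of G] Core_subset_verts[of G]
    unfolding Rank_C_S Rank_G by (auto simp: vecs_def C_S_def)
  moreover have "Rank (C_N G) \<subseteq> Rank G"
    unfolding Rank_C_N Rank_G
  proof clarify
    fix y assume y: "y \<in> vecs (C_N G)"
    have "x \<bullet> y = 0" if "x \<in> Null G" for x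
      using Null_inner_cong[OF that, of y 0] y by (auto simp: vecs_def C_N_def Npart_def)
    then show "y \<in> vecs G \<and> (\<forall>x\<in>Null G. x \<bullet> y = 0)"
      using y by (auto simp: vecs_def C_N_def Npart_def)
  qed
  moreover have "Rank G \<subseteq> span (Rank (C_S G) \<union> Rank (C_N G))"
  proof
    fix y assume y: "y \<in> Rank G"
    define a where "a = lift (C_S G) y"
    define b where "b = lift (C_N G) y"
    have "x \<bullet> a = x \<bullet> y" if "x \<in> Null G" for x
      using that by (rule Null_inner_cong) (simp add: a_def lift_def C_S_def)
    then have "a \<in> Rank (C_S G)"
      using y unfolding Rank_C_S Rank_G by (auto simp: a_def vecs_def lift_def)
    moreover have "b \<in> Rank (C_N G)"
      unfolding Rank_C_N by (simp add: b_def vecs_def lift_def)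
    moreover have "y = a + b"
      using y unfolding Rank_G
      by (auto simp: a_def b_def lift_def vec_eq_iff vecs_def C_S_def C_N_def Npart_def)
    ultimately show "y \<in> span (Rank (C_S G) \<union> Rank (C_N G))"
      by (auto intro!: span_add intro: span_base)
  qed
  ultimately have "Rank G = span (Rank (C_S G) \<union> Rank (C_N G))"
    by (intro subset_antisym span_minimal) (auto simp: Rank_def)
  then show "Rank G = span (\<Union>b\<in>UNIV. case_bool (lift (C_S G) ` Rank (C_S G)) (lift (C_N G) ` Rank (C_N G)) b)"
    unfolding lift_eq by (simp add: UNIV_bool Un_commute)
qed simp

end

section \<open>Rank formulas and the full decomposition\<close>

lemma graph_rank_eq_sum_components:
  assumes "sym_digraph G"
  shows "graph_rank G = (\<Sum>H\<in>conn_components G. graph_rank H)"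
proof -
  have "graph_rank G = (\<Sum>H\<in>conn_components G. dim (lift H ` Rank H))"
    unfolding graph_rank_def by (rule dim_is_direct_sum[OF Rank_direct_sum_components[OF assms]])
  also have "\<dots> = (\<Sum>H\<in>conn_components G. graph_rank H)"
    by (intro sum.cong refl)
      (simp add: lift_image_Rank graph_rank_def conn_components_def pre_digraph.max_subgraph_def subgraph_def)
  finally show ?thesis .
qed

theorem theorem5p2:
  fixes G :: "('a::finite, 'b) pre_digraph"
  assumes "graph G"
    and "C4k_free_bipartite G"
  shows "(graph_rank G = graph_rank (C_S G) + graph_rank (C_N G) \<and>
       graph_rank (C_S G) + graph_rank (C_N G) =
         (\<Sum>H\<in>conn_components (C_S G). graph_rank H) + (\<Sum>H\<in>conn_components (C_N G). graph_rank H)) \<and>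
     is_direct_sum (Rank G) (UNIV :: bool set)
       (case_bool (lift (C_S G) ` Rank (C_S G)) (lift (C_N G) ` Rank (C_N G))) \<and>
     is_direct_sum (Rank G) (conn_components (C_S G) <+> conn_components (C_N G))
       (case_sum (\<lambda>H. lift H ` Rank H) (\<lambda>H. lift H ` Rank H))"
proof -
  note sym = sym_digraph_C_S[OF assms] sym_digraph_C_N[OF assms]
  note two = Rank_direct_sum_C_S_C_N[OF assms]
  have lift_eq: "lift (C_S G) ` Rank (C_S G) = Rank (C_S G)" "lift (C_N G) ` Rank (C_N G) = Rank (C_N G)"
    using sym by (auto simp: lift_image_Rank sym_digraph_def)
  have "graph_rank G = graph_rank (C_S G) + graph_rank (C_N G)"
    using dim_is_direct_sum[OF two] by (simp add: lift_eq graph_rank_def UNIV_bool)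
  \<comment> \<open>Both terms of the two-term splitting are refined by their component
    decompositions.\<close>
  moreover have "is_direct_sum (Rank G) (conn_components (C_S G) <+> conn_components (C_N G))
       (case_sum (\<lambda>H. lift H ` Rank H) (\<lambda>H. lift H ` Rank H))"
    using is_direct_sum_Plus[OF two[unfolded lift_eq]] sym Rank_direct_sum_components by blast
  ultimately show ?thesis
    using two graph_rank_eq_sum_components[OF sym(1)] graph_rank_eq_sum_components[OF sym(2)] by simp
qed

end
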